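(* Let $PL$ be the plurality social choice correspondence. If $|A|\ge 3$ and $|I|\in\{2,3\}$, then $PL$ is $\mathbf{K}$-strategy-proof. If $|A|\ge 3$ and $|I|\ge 4$, then $PL$ is $\Omega^{PL}$-$\mathbf{K}$-manipulable.
   Context: Standing setting: $A$ (alternatives) and $I$ (individuals) are finite sets with $|A|\ge 2$, $|I|\ge 2$. $P_0(X)$ is the set of nonempty subsets of $X$. For a relation $R$ on a set $X$, $x\succeq_R y$ means $(x,y)\in R$, and $x\succ_R y$ means $(x,y)\in R$ and $(y,x)\notin R$. $\mathcal{L}(A)$ is the set of linear orders (complete, transitive, antisymmetric relations) on $A$; for $q\in\mathcal{L}(A)$, $\mathrm{rank}_q(x)=|\{y\in A: y\succeq_q x\}|$ (so rank $1$ is best). For $J\subseteq I$, $\mathcal{L}(A)^J$ is the set of functions $J\to\mathcal{L}(A)$. For $i\in I$, $\overline{p}\in\mathcal{L}(A)^{I\setminus\{i\}}$, $q\in\mathcal{L}(A)$, $(\overline{p},q[i])\in\mathcal{L}(A)^I$ is the profile equal to $q$ at $i$ and to $\overline{p}(j)$ at every $j\ne i$. A social choice correspondence (scc) is a function $F:\mathcal{L}(A)^I\to P_0(A)$. Plurality: for $p\in\mathcal{L}(A)^I$, $PL(p)=\mathrm{argmax}_{x\in A}|\{i\in I:\mathrm{rank}_{p(i)}(x)=1\}|$ (set of all maximizers). Kelly extension rule: for $q\in\mathcal{L}(A)$, $\mathbf{K}(q)$ is the relation on $P_0(A)$ given by $(B,C)\in\mathbf{K}(q)$ iff $B=C$ or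 $x\succeq_q y$ for all $x\in B$, $y\in C$. A scc $F$ is $\mathbf{K}$-manipulable if there exist $i\in I$, $q,q'\in\mathcal{L}(A)$ and $\overline{p}\in\mathcal{L}(A)^{I\setminus\{i\}}$ with $F(\overline{p},q'[i])\succ_{\mathbf{K}(q)}F(\overline{p},q[i])$; it is $\mathbf{K}$-strategy-proof if it is not $\mathbf{K}$-manipulable. Winner information: for a scc $F$, $i\in I$, $q\in\mathcal{L}(A)$, $\Omega^F_i(q)=\big\{\{\overline{p}\in\mathcal{L}(A)^{I\setminus\{i\}}:F(\overline{p},q[i])=X\}: X\in\mathrm{Im}(F)\big\}\setminus\{\varnothing\}$. A scc $F$ is $\Omega^F$-$\mathbf{K}$-manipulable if there exist $i\in I$, $q,q'\in\mathcal{L}(A)$ and $\omega\in\Omega^F_i(q)$ such that $F(\overline{p}',q'[i])\succ_{\mathbf{K}(q)}F(\overline{p}',q[i])$ for some $\overline{p}'\in\omega$, and $F(\overline{p},q'[i])\succeq_{\mathbf{K}(q)}F(\overline{p},q[i])$ for every $\overline{p}\in\omega$. *)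

theory Defs
  imports Main "HOL-Library.FuncSet"
begin

text \<open>Throughout, \<open>(x, y) \<in> R\<close> means that \<open>x\<close> is at least as good as \<open>y\<close>.\<close>

definition strict :: "'x rel \<Rightarrow> 'x rel" where
  "strict R = {(x, y). (x, y) \<in> R \<and> (y, x) \<notin> R}"

definition nonempty_subsets :: "'x set \<Rightarrow> 'x set set" where
  "nonempty_subsets X = Pow X - {{}}"

definition lin_orders :: "'a set \<Rightarrow> 'a rel set" where
  "lin_orders A = {q. linear_order_on A q}"

definition rank :: "'a set \<Rightarrow> 'a rel \<Rightarrow> 'a \<Rightarrow> nat" where
  "rank A q x = card {y \<in> A. (y, x) \<in> q}"

text \<open>
  Profiles are extensional functions, so that they correspond exactly to the functions
  from \<open>J\<close> to the linear orders on \<open>A\<close>. For \<open>i \<in> I\<close> and \<open>pbar \<in> profiles A (I - {i})\<close>, the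
  function update \<open>pbar(i := q)\<close> is the profile on \<open>I\<close> completing \<open>pbar\<close> by \<open>q\<close> at \<open>i\<close>.
\<close>

definition profiles :: "'a set \<Rightarrow> 'i set \<Rightarrow> ('i \<Rightarrow> 'a rel) set" where
  "profiles A J = J \<rightarrow>\<^sub>E lin_orders A"

definition scc :: "'a set \<Rightarrow> 'i set \<Rightarrow> (('i \<Rightarrow> 'a rel) \<Rightarrow> 'a set) \<Rightarrow> bool" where
  "scc A I F \<longleftrightarrow> F \<in> profiles A I \<rightarrow> nonempty_subsets A"

definition PL :: "'a set \<Rightarrow> 'i set \<Rightarrow> ('i \<Rightarrow> 'a rel) \<Rightarrow> 'a set" where
  "PL A I p = {x. is_arg_max (\<lambda>x. card {i \<in> I. rank A (p i) x = 1}) (\<lambda>x. x \<in> A) x}"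

lemma scc_PL:
  assumes "finite A" and "A \<noteq> {}"
  shows "scc A I (PL A I)"
proof -
  have "PL A I p \<in> nonempty_subsets A" for p
  proof -
    let ?f = "\<lambda>x. card {i \<in> I. rank A (p i) x = 1}"
    have "Max (?f ` A) \<in> ?f ` A"
      using assms by (intro Max_in) auto
    then obtain x where x: "x \<in> A" "?f x = Max (?f ` A)"
      by force
    have "\<forall>y\<in>A. ?f y \<le> ?f x"
      using assms(1) unfolding x(2) by simp
    then have "x \<in> PL A I p"
      using x(1) by (auto simp: PL_def is_arg_max_def not_less)
    then show ?thesis
      by (auto simp: nonempty_subsets_def PL_def is_arg_max_def)
  qed
  then show ?thesis
    by (simp add: scc_def)
qed

definition Kelly :: "'a set \<Rightarrow> 'a rel \<Rightarrow> 'a set rel" where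
  "Kelly A q = {(B, C). B \<in> nonempty_subsets A \<and> C \<in> nonempty_subsets A \<and>
     (B = C \<or> (\<forall>x\<in>B. \<forall>y\<in>C. (x, y) \<in> q))}"

text \<open>
  Manipulability is defined for an arbitrary extension rule \<open>E\<close>, which turns a linear order
  on \<open>A\<close> into a relation on the nonempty subsets of \<open>A\<close>.
\<close>

definition manipulable ::
  "('a rel \<Rightarrow> 'a set rel) \<Rightarrow> 'a set \<Rightarrow> 'i set \<Rightarrow> (('i \<Rightarrow> 'a rel) \<Rightarrow> 'a set) \<Rightarrow> bool" where
  "manipulable E A I F \<longleftrightarrow>
     (\<exists>i\<in>I. \<exists>q\<in>lin_orders A. \<exists>q'\<in>lin_orders A. \<exists>pbar\<in>profiles A (I - {i}).
        (F (pbar(i := q')), F (pbar(i := q))) \<in> strict (E q))"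

definition strategy_proof ::
  "('a rel \<Rightarrow> 'a set rel) \<Rightarrow> 'a set \<Rightarrow> 'i set \<Rightarrow> (('i \<Rightarrow> 'a rel) \<Rightarrow> 'a set) \<Rightarrow> bool" where
  "strategy_proof E A I F \<longleftrightarrow> \<not> manipulable E A I F"

definition winner_info ::
  "'a set \<Rightarrow> 'i set \<Rightarrow> (('i \<Rightarrow> 'a rel) \<Rightarrow> 'a set) \<Rightarrow> 'i \<Rightarrow> 'a rel \<Rightarrow> ('i \<Rightarrow> 'a rel) set set" where
  "winner_info A I F i q =
     (\<lambda>X. {pbar \<in> profiles A (I - {i}). F (pbar(i := q)) = X}) ` (F ` profiles A I) - {{}}"

definition info_manipulable ::
  "('i \<Rightarrow> 'a rel \<Rightarrow> ('i \<Rightarrow> 'a rel) set set) \<Rightarrow> ('a rel \<Rightarrow> 'a set rel) \<Rightarrow>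
   'a set \<Rightarrow> 'i set \<Rightarrow> (('i \<Rightarrow> 'a rel) \<Rightarrow> 'a set) \<Rightarrow> bool" where
  "info_manipulable Om E A I F \<longleftrightarrow>
     (\<exists>i\<in>I. \<exists>q\<in>lin_orders A. \<exists>q'\<in>lin_orders A. \<exists>w\<in>Om i q.
        (\<exists>pbar\<in>w. (F (pbar(i := q')), F (pbar(i := q))) \<in> strict (E q)) \<and>
        (\<forall>pbar\<in>w. (F (pbar(i := q')), F (pbar(i := q))) \<in> E q))"

end

theory Submission
  imports Defs
begin

text \<open>
  A single ballot only adds one vote to its top alternative. With at most two other voters, a
  truthful ballot for \<open>a\<close> either makes \<open>a\<close> a winner, in which case a better outcome could only be
  \<open>{a}\<close>, or meets two identical ballots, which decide the election.

  With at least three other voters, let the manipulator rank \<open>a\<close> first, \<open>c\<close> second and \<open>b\<close> below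
  \<open>c\<close>, and let the others split as evenly as possible between \<open>b\<close> and \<open>c\<close>, with any odd vote going
  to \<open>b\<close>. The truthful winner set is \<open>{b}\<close> or \<open>{b, c}\<close>. Voting for \<open>c\<close> instead turns \<open>{b, c}\<close> into
  \<open>{c}\<close>, and \<open>{b}\<close> into \<open>{b}\<close> or \<open>{b, c}\<close>, whatever the other ballots consistent with the
  information are.
\<close>

section \<open>Plurality as maximization of a vote count\<close>

text \<open>The electorate \<open>J\<close> is a parameter so that the same count serves all of
  \<open>I\<close> and the voters other than the manipulator.\<close>

definition votes :: "'a set \<Rightarrow> 'i set \<Rightarrow> ('i \<Rightarrow> 'a rel) \<Rightarrow> 'a \<Rightarrow> nat" where
  "votes A J p x = card {j \<in> J. rank A (p j) x = 1}"

definition maximizers :: "'a set \<Rightarrow> ('a \<Rightarrow> nat) \<Rightarrow> 'a set" where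
  "maximizers A s = {x \<in> A. \<forall>y\<in>A. s y \<le> s x}"

lemma PL_eq_maximizers: "PL A I p = maximizers A (votes A I p)"
  by (auto simp: PL_def maximizers_def votes_def is_arg_max_def not_less)

lemma maximizers_cong:
  assumes "\<And>x. x \<in> A \<Longrightarrow> s x = t x"
  shows "maximizers A s = maximizers A t"
  using assms by (auto simp: maximizers_def)

section \<open>Top alternatives of linear orders\<close>

lemma lin_ordersD:
  assumes "q \<in> lin_orders A"
  shows lin_orders_refl: "x \<in> A \<Longrightarrow> (x, x) \<in> q"
    and lin_orders_antisym: "(x, y) \<in> q \<Longrightarrow> (y, x) \<in> q \<Longrightarrow> x = y"
    and lin_orders_total: "x \<in> A \<Longrightarrow> y \<in> A \<Longrightarrow> (x, y) \<in> q \<or> (y, x) \<in> q"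
proof -
  have q: "refl_on A q" "antisym q" "total_on A q"
    using assms by (auto simp: lin_orders_def order_on_defs)
  show "x \<in> A \<Longrightarrow> (x, x) \<in> q"
    using q(1) by (rule refl_onD)
  show "(x, y) \<in> q \<Longrightarrow> (y, x) \<in> q \<Longrightarrow> x = y"
    using q(2) by (rule antisymD)
  show "x \<in> A \<Longrightarrow> y \<in> A \<Longrightarrow> (x, y) \<in> q \<or> (y, x) \<in> q"
    using q(1,3) by (cases "x = y") (auto simp: refl_on_def total_on_def)
qed

lemma rank_eq_1_iff:
  assumes "q \<in> lin_orders A" "x \<in> A"
  shows "rank A q x = 1 \<longleftrightarrow> (\<forall>y\<in>A. (x, y) \<in> q)"
proof -
  have x: "x \<in> {y \<in> A. (y, x) \<in> q}"
    using lin_orders_refl[OF assms] assms(2) by simp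
  have "rank A q x = 1 \<longleftrightarrow> {y \<in> A. (y, x) \<in> q} = {x}"
  proof
    assume "rank A q x = 1"
    then obtain z where z: "{y \<in> A. (y, x) \<in> q} = {z}"
      unfolding rank_def using card_1_singletonE by blast
    with x show "{y \<in> A. (y, x) \<in> q} = {x}"
      by (metis singletonD)
  qed (simp add: rank_def)
  also have "\<dots> \<longleftrightarrow> (\<forall>y\<in>A. (y, x) \<in> q \<longrightarrow> y = x)"
    using x by auto
  also have "\<dots> \<longleftrightarrow> (\<forall>y\<in>A. (x, y) \<in> q)"
    using lin_orders_total[OF assms(1)] lin_orders_antisym[OF assms(1)] assms(2) by metis
  finally show ?thesis .
qed

lemma rank_eq_1_iff_eq_top:
  assumes "q \<in> lin_orders A" "a \<in> A" "\<forall>y\<in>A. (a, y) \<in> q" "x \<in> A"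
  shows "rank A q x = 1 \<longleftrightarrow> x = a"
  using assms(2-4) rank_eq_1_iff[OF assms(1,4)] lin_orders_antisym[OF assms(1), of x a] by auto

lemma lin_order_top_exists:
  assumes "finite A" "A \<noteq> {}" "q \<in> lin_orders A"
  shows "\<exists>a\<in>A. \<forall>y\<in>A. (a, y) \<in> q"
proof -
  have trans: "trans q"
    using assms(3) by (simp add: lin_orders_def order_on_defs)
  \<comment> \<open>The induction runs over subsets \<open>B\<close> while \<open>q\<close> stays a
    linear order on the fixed set \<open>A\<close>.\<close>
  have "\<exists>a\<in>B. \<forall>y\<in>B. (a, y) \<in> q" if "finite B" "B \<noteq> {}" "B \<subseteq> A" for B
    using that
  proof (induction rule: finite_ne_induct)
    case (singleton x)
    then show ?case
      using lin_orders_refl[OF assms(3)] by auto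
  next
    case (insert x B)
    then obtain a where a: "a \<in> B" "\<forall>y\<in>B. (a, y) \<in> q"
      by auto
    have "(a, x) \<in> q \<or> (x, a) \<in> q"
      using insert.prems a(1) lin_orders_total[OF assms(3), of a x] by auto
    then show ?case
    proof
      assume "(a, x) \<in> q"
      with a show ?thesis by auto
    next
      assume "(x, a) \<in> q"
      then have "\<forall>y\<in>B. (x, y) \<in> q"
        using a(2) trans by (meson transD)
      then show ?thesis
        using insert.prems lin_orders_refl[OF assms(3)] by auto
    qed
  qed
  with assms show ?thesis by blast
qed

section \<open>Ballots with prescribed leading alternatives\<close>

text \<open>Ballots are built from an arbitrary order of the remaining alternatives by putting the
  prescribed ones on top, one at a time.\<close>

lemma lin_orders_insert_top:
  assumes "r \<in> lin_orders B" "x \<notin> B"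
  shows "{x} \<times> insert x B \<union> r \<in> lin_orders (insert x B)"
proof -
  let ?R = "{x} \<times> insert x B \<union> r"
  have r: "r \<subseteq> B \<times> B" "refl_on B r" "trans r" "antisym r" "total_on B r"
    using assms(1) by (auto simp: lin_orders_def order_on_defs)
  have "refl_on (insert x B) ?R" "total_on (insert x B) ?R"
    using r(2,5) by (auto simp: refl_on_def total_on_def)
  moreover have "trans ?R"
    using r(1,3) assms(2) unfolding trans_def by blast
  moreover have "antisym ?R"
    using r(1,4) assms(2) unfolding antisym_def by blast
  ultimately show ?thesis
    using r(1) by (auto simp: lin_orders_def order_on_defs)
qed

lemma lin_orders_nonempty: "\<exists>r. r \<in> lin_orders A"
  using well_order_on[of A] by (auto simp: lin_orders_def well_order_on_def)

lemma lin_order_with_top: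
  assumes "a \<in> A"
  shows "\<exists>q\<in>lin_orders A. \<forall>y\<in>A. (a, y) \<in> q"
proof -
  obtain r where "r \<in> lin_orders (A - {a})"
    using lin_orders_nonempty by blast
  from lin_orders_insert_top[OF this, of a] assms have "{a} \<times> A \<union> r \<in> lin_orders A"
    by (simp add: insert_absorb)
  then show ?thesis
    by (rule bexI[rotated]) simp
qed

lemma lin_order_with_top_two:
  assumes "a \<in> A" "c \<in> A" "a \<noteq> c"
  shows "\<exists>q\<in>lin_orders A. (\<forall>y\<in>A. (a, y) \<in> q) \<and> (\<forall>y\<in>A - {a}. (c, y) \<in> q)"
proof -
  obtain r where r: "r \<in> lin_orders (A - {a})" "\<forall>y\<in>A - {a}. (c, y) \<in> r"
    using lin_order_with_top[of c "A - {a}"] assms by auto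
  from lin_orders_insert_top[OF r(1), of a] assms(1) have "{a} \<times> A \<union> r \<in> lin_orders A"
    by (simp add: insert_absorb)
  then show ?thesis
    by (rule bexI[rotated]) (use r(2) in simp)
qed

section \<open>Effect of a single ballot on the count\<close>

lemma votes_fun_upd:
  assumes "finite I" "i \<in> I"
  shows "votes A I (p(i := q)) x = votes A (I - {i}) p x + of_bool (rank A q x = 1)"
proof -
  have "{j \<in> I. rank A ((p(i := q)) j) x = 1}
      = {j \<in> I - {i}. rank A (p j) x = 1} \<union> (if rank A q x = 1 then {i} else {})"
    using assms by auto
  then show ?thesis
    using assms(1) by (simp add: votes_def)
qed

lemma PL_fun_upd:
  assumes "finite I" "i \<in> I" "q \<in> lin_orders A" "a \<in> A" "\<forall>y\<in>A. (a, y) \<in> q"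
  shows "PL A I (p(i := q)) = maximizers A (\<lambda>x. votes A (I - {i}) p x + of_bool (x = a))"
  unfolding PL_eq_maximizers
  by (intro maximizers_cong)
    (simp add: votes_fun_upd[OF assms(1,2)] rank_eq_1_iff_eq_top[OF assms(3-5), simplified])

text \<open>A ballot has only one top, so the supporters of \<open>x\<close> and of \<open>y\<close>
  are disjoint groups of voters.\<close>

lemma votes_add_le:
  assumes "finite J" "p \<in> profiles A J" "x \<in> A" "y \<in> A" "x \<noteq> y"
  shows "votes A J p x + votes A J p y \<le> card J"
proof -
  let ?T = "\<lambda>x. {j \<in> J. rank A (p j) x = 1}"
  have "?T x \<inter> ?T y = {}"
  proof -
    have False if "j \<in> J" "rank A (p j) x = 1" "rank A (p j) y = 1" for j
    proof -
      have pj: "p j \<in> lin_orders A"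
        using assms(2) that(1) by (auto simp: profiles_def)
      have "(x, y) \<in> p j" "(y, x) \<in> p j"
        using that(2,3) assms(3,4) rank_eq_1_iff[OF pj] by blast+
      then show False
        using lin_orders_antisym[OF pj] assms(5) by blast
    qed
    then show ?thesis by auto
  qed
  then have "votes A J p x + votes A J p y = card (?T x \<union> ?T y)"
    using assms(1) by (simp add: votes_def card_Un_disjoint)
  also have "\<dots> \<le> card J"
    using assms(1) by (intro card_mono) auto
  finally show ?thesis .
qed

section \<open>Strategy-proofness with at most three voters\<close>

text \<open>Here \<open>s\<close> counts the ballots of the others, \<open>a\<close> is the true top
  and \<open>c\<close> the top of the misreport. None of the three outcomes permits a Kelly
  improvement from \<open>X\<close> to \<open>Y\<close> when \<open>a\<close> is the true
  top.\<close>

lemma maximizers_few_votes: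
  fixes s :: "'a \<Rightarrow> nat"
  assumes "\<And>x y. x \<in> A \<Longrightarrow> y \<in> A \<Longrightarrow> x \<noteq> y \<Longrightarrow> s x + s y \<le> 2" and "a \<in> A" "c \<in> A" "a \<noteq> c"
  defines "X \<equiv> maximizers A (\<lambda>x. s x + of_bool (x = a))"
    and "Y \<equiv> maximizers A (\<lambda>x. s x + of_bool (x = c))"
  shows "X = {a} \<or> X = Y \<or> a \<in> X \<and> a \<notin> Y"
proof (cases "s a = 0")
  case False
  \<comment> \<open>One vote for \<open>a\<close> leaves at most one for any rival, and the truthful
    ballot breaks the tie.\<close>
  have "s y + of_bool (y = a) < s a + 1" if "y \<in> A" "y \<noteq> a" for y
    using assms(1)[of y a] that assms(2) False by simp
  then have "X = {a}"
    using assms(2) unfolding X_def maximizers_def by fastforce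
  then show ?thesis by simp
next
  case True
  \<comment> \<open>After the switch \<open>a\<close> has score 0, while \<open>c\<close> has at
    least 1.\<close>
  have "a \<notin> Y"
    using True assms(3,4) unfolding Y_def maximizers_def by (auto intro!: bexI[of _ c])
  show ?thesis
  proof (cases "a \<in> X")
    case True
    with \<open>a \<notin> Y\<close> show ?thesis by simp
  next
    case False
    then obtain x where x: "x \<in> A" "s a + 1 < s x + of_bool (x = a)"
      using assms(2) unfolding X_def maximizers_def by (auto simp: not_le)
    then have x: "x \<in> A" "x \<noteq> a" "s x \<ge> 2"
      using \<open>s a = 0\<close> by (cases "x = a"; simp)+
    \<comment> \<open>The two votes for \<open>x\<close> exhaust the bound, so one further ballot
      for any \<open>d\<close> cannot catch up with \<open>x\<close>.\<close>
    have *: "s y = 0" if "y \<in> A" "y \<noteq> x" for y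
      using assms(1)[of x y] that x by simp
    have "maximizers A (\<lambda>z. s z + of_bool (z = d)) = {x}" for d
    proof -
      have "s y + of_bool (y = d) < s x + of_bool (x = d)" if "y \<in> A" "y \<noteq> x" for y
        using *[OF that] x(3) by simp
      then show ?thesis
        using x(1) unfolding maximizers_def by fastforce
    qed
    then show ?thesis
      by (simp add: X_def Y_def)
  qed
qed

lemma PL_strategy_proof:
  fixes A :: "'a set" and I :: "'i set"
  assumes "finite A" "finite I" "A \<noteq> {}" "card I \<le> 3"
  shows "strategy_proof (Kelly A) A I (PL A I)"
  unfolding strategy_proof_def manipulable_def
proof (clarify)
  fix i q q' p
  assume i: "i \<in> I" and q: "q \<in> lin_orders A" and q': "q' \<in> lin_orders A"
    and p: "p \<in> profiles A (I - {i})"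
    and strict: "(PL A I (p(i := q')), PL A I (p(i := q))) \<in> strict (Kelly A q)"
  obtain a where a: "a \<in> A" "\<forall>y\<in>A. (a, y) \<in> q"
    using lin_order_top_exists[OF assms(1,3) q] by blast
  obtain c where c: "c \<in> A" "\<forall>y\<in>A. (c, y) \<in> q'"
    using lin_order_top_exists[OF assms(1,3) q'] by blast
  let ?s = "votes A (I - {i}) p"
  let ?X = "maximizers A (\<lambda>x. ?s x + of_bool (x = a))"
  let ?Y = "maximizers A (\<lambda>x. ?s x + of_bool (x = c))"
  have K: "(?Y, ?X) \<in> strict (Kelly A q)"
    using strict unfolding PL_fun_upd[OF assms(2) i q a] PL_fun_upd[OF assms(2) i q' c] .
  then have neq: "?Y \<noteq> ?X"
    by (auto simp: strict_def)
  with K have Y: "?Y \<noteq> {}" "?Y \<subseteq> A" and le: "\<forall>y\<in>?Y. \<forall>x\<in>?X. (y, x) \<in> q"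
    by (auto simp: strict_def Kelly_def nonempty_subsets_def)
  \<comment> \<open>Every member of \<open>?Y\<close> must be at least as good as the top
    \<open>a\<close>, hence equal to it.\<close>
  have "?Y = {a}" if "a \<in> ?X"
    using that Y le a(2) lin_orders_antisym[OF q] by blast
  moreover have "card (I - {i}) \<le> 2"
    using assms(2,4) i by simp
  then have "?s x + ?s y \<le> 2" if "x \<in> A" "y \<in> A" "x \<noteq> y" for x y
    using votes_add_le[OF _ p that] assms(2) by simp
  moreover have "a \<noteq> c"
    using neq by auto
  ultimately show False
    using maximizers_few_votes[of A ?s a c] a(1) c(1) neq by blast
qed

section \<open>Manipulation with at least four voters\<close>

text \<open>The possible \<open>Y\<close> are determined by \<open>X\<close> alone, whatever
  \<open>s\<close> is; this is what makes the conclusion hold on a whole information set.\<close>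

lemma maximizers_switch:
  fixes s :: "'a \<Rightarrow> nat"
  assumes "a \<noteq> b" "b \<noteq> c" "a \<noteq> c" "c \<in> A"
  defines "X \<equiv> maximizers A (\<lambda>x. s x + of_bool (x = a))"
    and "Y \<equiv> maximizers A (\<lambda>x. s x + of_bool (x = c))"
  assumes X: "b \<in> X" "X \<subseteq> {b, c}"
  shows "X = {b, c} \<and> Y = {c} \<or> X = {b} \<and> (Y = {b} \<or> Y = {b, c})"
proof -
  have b: "b \<in> A" and max: "\<And>y. y \<in> A \<Longrightarrow> s y + of_bool (y = a) \<le> s b"
    using X(1) assms(1) by (auto simp: X_def maximizers_def)
  have less: "s y + of_bool (y = a) < s b" if "y \<in> A" "y \<notin> X" for y
  proof -
    obtain z where "z \<in> A" "s y + of_bool (y = a) < s z + of_bool (z = a)"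
      using \<open>y \<in> A\<close> \<open>y \<notin> X\<close> by (auto simp: X_def maximizers_def not_le)
    with max[of z] show ?thesis by linarith
  qed
  \<comment> \<open>The remaining alternatives trail \<open>b\<close> strictly, so they stay losers
    once the extra vote moves to \<open>c\<close>.\<close>
  have other: "s y < s b" if "y \<in> A" "y \<noteq> b" "y \<noteq> c" for y
  proof -
    have "y \<notin> X"
      using that X(2) by blast
    with less[OF that(1)] show ?thesis by simp
  qed
  show ?thesis
  proof (cases "c \<in> X")
    case True
    then have "s c = s b"
      using max[of c] b assms(1,3,4) by (fastforce simp: X_def maximizers_def)
    then have "s y + of_bool (y = c) < s c + 1" if "y \<in> A" "y \<noteq> c" for y
      using other[of y] that by (cases "y = b") auto
    then have "Y = {c}"
      using assms(4) unfolding Y_def maximizers_def by fastforce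
    with True X show ?thesis by auto
  next
    case False
    \<comment> \<open>Scores are integers, so with one more vote \<open>c\<close> can at most draw
      level with \<open>b\<close>.\<close>
    then have "s c < s b"
      using less[of c] assms(3,4) by simp
    then have "b \<in> Y"
      using b other assms(2) unfolding Y_def maximizers_def by (force simp: less_imp_le)
    moreover have "Y \<subseteq> {b, c}"
    proof
      fix y
      assume "y \<in> Y"
      then have "y \<in> A" "s b \<le> s y + of_bool (y = c)"
        using b assms(2) by (auto simp: Y_def maximizers_def)
      then show "y \<in> {b, c}"
        using other[of y] by (cases "y = c") auto
    qed
    ultimately show ?thesis
      using X False by auto
  qed
qed

text \<open>Since \<open>c\<close> is preferred to \<open>b\<close>, both \<open>{c}\<close> against
  \<open>{b, c}\<close> and \<open>{b, c}\<close> against \<open>{b}\<close> are strict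
  improvements; in the only other case the outcome is unchanged and \<open>c\<close> does not
  win.\<close>

lemma PL_Kelly_switch:
  fixes A :: "'a set" and I :: "'i set"
  assumes "finite I" "i \<in> I"
    and abc: "a \<in> A" "b \<in> A" "c \<in> A" "a \<noteq> b" "b \<noteq> c" "a \<noteq> c"
    and q: "q \<in> lin_orders A" "\<forall>y\<in>A. (a, y) \<in> q" "(c, b) \<in> q"
    and q': "q' \<in> lin_orders A" "\<forall>y\<in>A. (c, y) \<in> q'"
    and X: "b \<in> PL A I (p(i := q))" "PL A I (p(i := q)) \<subseteq> {b, c}"
  shows "(PL A I (p(i := q')), PL A I (p(i := q))) \<in> Kelly A q"
    and "c \<in> PL A I (p(i := q')) \<Longrightarrow>
      (PL A I (p(i := q')), PL A I (p(i := q))) \<in> strict (Kelly A q)"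
proof -
  let ?X = "PL A I (p(i := q))" and ?Y = "PL A I (p(i := q'))"
  have eqs: "?X = maximizers A (\<lambda>x. votes A (I - {i}) p x + of_bool (x = a))"
    "?Y = maximizers A (\<lambda>x. votes A (I - {i}) p x + of_bool (x = c))"
    by (rule PL_fun_upd[OF assms(1,2) q(1) abc(1) q(2)])
      (rule PL_fun_upd[OF assms(1,2) q'(1) abc(3) q'(2)])
  have sw: "?X = {b, c} \<and> ?Y = {c} \<or> ?X = {b} \<and> (?Y = {b} \<or> ?Y = {b, c})"
    using maximizers_switch[OF abc(4-6,3)] X unfolding eqs by blast
  have "(b, b) \<in> q" "(c, c) \<in> q" "(b, c) \<notin> q"
    using lin_orders_refl[OF q(1)] lin_orders_antisym[OF q(1) q(3)] abc(2,3,5) by auto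
  note simps = this q(3) abc Kelly_def strict_def nonempty_subsets_def
  from sw consider "?X = {b, c}" "?Y = {c}" | "?X = {b}" "?Y = {b}" | "?X = {b}" "?Y = {b, c}"
    by blast
  then have "(?Y, ?X) \<in> Kelly A q \<and> (c \<in> ?Y \<longrightarrow> (?Y, ?X) \<in> strict (Kelly A q))"
    by cases (simp_all add: simps abc(5)[symmetric])
  then show "(?Y, ?X) \<in> Kelly A q" and "c \<in> ?Y \<Longrightarrow> (?Y, ?X) \<in> strict (Kelly A q)"
    by blast+
qed

lemma PL_info_manipulable:
  fixes A :: "'a set" and I :: "'i set"
  assumes "finite I" "card A \<ge> 3" "card I \<ge> 4"
  shows "info_manipulable (winner_info A I (PL A I)) (Kelly A) A I (PL A I)"
proof -
  obtain B where "B \<subseteq> A" "card B = 3"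
    using obtain_subset_with_card_n[OF assms(2)] by metis
  then obtain a b c where abc: "a \<in> A" "b \<in> A" "c \<in> A" "a \<noteq> b" "b \<noteq> c" "a \<noteq> c"
    by (auto simp: card_3_iff)
  obtain i where i: "i \<in> I"
    using assms(3) by fastforce
  obtain q where q: "q \<in> lin_orders A" "\<forall>y\<in>A. (a, y) \<in> q" "(c, b) \<in> q"
    using lin_order_with_top_two[of a A c] abc by blast
  obtain qb where qb: "qb \<in> lin_orders A" "\<forall>y\<in>A. (b, y) \<in> qb"
    using lin_order_with_top abc(2) by metis
  obtain qc where qc: "qc \<in> lin_orders A" "\<forall>y\<in>A. (c, y) \<in> qc"
    using lin_order_with_top abc(3) by metis
  let ?n = "card (I - {i})"
  have n: "?n \<ge> 3"
    using assms(1,3) i by simp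
  \<comment> \<open>\<open>J\<close> will be the supporters of \<open>b\<close>: half of the others,
    rounded up. The rest vote for \<open>c\<close>.\<close>
  obtain J where J: "J \<subseteq> I - {i}" "card J = (?n + 1) div 2"
  proof (rule obtain_subset_with_card_n)
    show "(?n + 1) div 2 \<le> ?n"
      using n by linarith
  qed
  define p where "p = (\<lambda>j\<in>I - {i}. if j \<in> J then qb else qc)"
  have p: "p \<in> profiles A (I - {i})"
    using qb qc by (auto simp: p_def profiles_def)
  have "{j \<in> I - {i}. rank A (p j) x = 1}
      = (if x = b then J else if x = c then I - {i} - J else {})" if "x \<in> A" for x
    using J(1) abc(5) rank_eq_1_iff_eq_top[OF qb(1) abc(2) qb(2) that]
      rank_eq_1_iff_eq_top[OF qc(1) abc(3) qc(2) that]
    by (auto simp: p_def)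
  moreover have "card (I - {i} - J) = ?n div 2"
    using J assms(1) by (subst card_Diff_subset) (auto intro: finite_subset)
  moreover define m l where "m = (?n + 1) div 2" and "l = ?n div 2"
  ultimately have votes: "votes A (I - {i}) p x = (if x = b then m else if x = c then l else 0)"
    if "x \<in> A" for x
    using that J(2) by (simp add: votes_def)
  \<comment> \<open>At least three other voters give \<open>m \<ge> 2\<close>, so \<open>b\<close>
    beats \<open>a\<close> with its single vote; \<open>m \<le> l + 1\<close> lets one more vote
    bring \<open>c\<close> level with \<open>b\<close> or ahead.\<close>
  have bounds: "m \<ge> 2" "l \<le> m" "m \<le> l + 1"
    using n unfolding m_def l_def by linarith+
  let ?X = "PL A I (p(i := q))"
  have "?X = maximizers A (\<lambda>x. if x = b then m else if x = c then l else of_bool (x = a))"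
    unfolding PL_fun_upd[OF assms(1) i q(1) abc(1) q(2)]
    using abc(4,6) by (intro maximizers_cong) (simp add: votes)
  note X_eq = this
  have X: "b \<in> ?X" "?X \<subseteq> {b, c}"
  proof -
    show "b \<in> ?X"
      using abc(2) bounds by (simp add: X_eq maximizers_def)
    show "?X \<subseteq> {b, c}"
    proof
      fix x
      assume "x \<in> ?X"
      then have "\<forall>y\<in>A. (if y = b then m else if y = c then l else of_bool (y = a))
          \<le> (if x = b then m else if x = c then l else of_bool (x = a))"
        by (simp add: X_eq maximizers_def)
      from bspec[OF this abc(2)] bounds(1) show "x \<in> {b, c}"
        by (auto simp: of_bool_def split: if_splits)
    qed
  qed
  have "PL A I (p(i := qc)) = maximizers A (\<lambda>x. if x = b then m else if x = c then l + 1 else 0)"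
    unfolding PL_fun_upd[OF assms(1) i qc(1) abc(3) qc(2)]
    using abc(5) by (intro maximizers_cong) (simp add: votes)
  then have "c \<in> PL A I (p(i := qc))"
    using abc(3,5) bounds by (simp add: maximizers_def)
  note strict = PL_Kelly_switch(2)[OF assms(1) i abc q qc X this]
  let ?w = "{p' \<in> profiles A (I - {i}). PL A I (p'(i := q)) = ?X}"
  \<comment> \<open>This puts \<open>?X\<close> into the image of \<open>PL\<close>, as the
    definition of winner information demands.\<close>
  have "p(i := q) \<in> profiles A I"
    using p q(1) i by (auto simp: profiles_def PiE_iff extensional_def)
  then have "?w \<in> winner_info A I (PL A I) i q"
    using p unfolding winner_info_def by blast
  \<comment> \<open>Every \<open>p'\<close> in \<open>?w\<close> shares the truthful winner set
    \<open>?X\<close>, and the weak comparison requires nothing else of the other ballots.\<close>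
  moreover have "(PL A I (p'(i := qc)), PL A I (p'(i := q))) \<in> Kelly A q" if "p' \<in> ?w" for p'
    using that X by (intro PL_Kelly_switch(1)[OF assms(1) i abc q qc]) auto
  moreover have "p \<in> ?w"
    using p by simp
  ultimately show ?thesis
    unfolding info_manipulable_def using strict
    by (intro bexI[OF _ i] bexI[OF _ q(1)] bexI[OF _ qc(1)] bexI[of _ ?w] conjI bexI[of _ p])
      (assumption | rule ballI | blast)+
qed

theorem theorem17:
  fixes A :: "'a set" and I :: "'i set"
  assumes "finite A" and "finite I" and "card A \<ge> 2" and "card I \<ge> 2"
  shows "(card A \<ge> 3 \<and> card I \<in> {2, 3} \<longrightarrow> strategy_proof (Kelly A) A I (PL A I)) \<and>
         (card A \<ge> 3 \<and> card I \<ge> 4 \<longrightarrow>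
            info_manipulable (winner_info A I (PL A I)) (Kelly A) A I (PL A I))"
proof -
  have "A \<noteq> {}"
    using assms(3) by auto
  with PL_strategy_proof[OF assms(1,2)] PL_info_manipulable[OF assms(2)] show ?thesis
    by auto
qed

end
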